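(* Let $m\geq 1$ and $b\geq 2$ be integers, let $\underline{\theta}\in\mathbb{R}^m$, and let $\mathcal{T}$ be any countable union of affine hyperplanes in $\mathbb{R}^m$. Then for every $w\in[0,1)$, \[ \dim_P\big(\mathcal{S}_{m,\underline{\theta}}(w)\setminus\mathcal{T}\big)\ \geq\ \dim_P\big(\mathcal{S}^{(b)}_{m,\underline{\theta}}(w)\setminus\mathcal{T}\big)\ \geq\ (1-w)m>0 . \] In particular, \[ \dim_P\big(\mathcal{S}_{m,\underline{\theta}}(1/m)\setminus\mathcal{T}\big)\ \geq\ \dim_P\big(\mathcal{S}^{(b)}_{m,\underline{\theta}}(1/m)\setminus\mathcal{T}\big)\ \geq\ m-1 . \]
   Context: Fix an arbitrary norm $\Vert\cdot\Vert$ on $\mathbb{R}^m$. For $\underline{\theta}\in\mathbb{R}^m$ and $w\geq 0$, $\mathcal{S}_{m,\underline{\theta}}(w)$ is the set of $\underline{x}\in\mathbb{R}^m$ such that for every $c>0$ there is $Q_0$ such that for all $Q\geq Q_0$ the system $1\leq q\leq Q$, $\Vert q\underline{x}-\underline{p}-\underline{\theta}\Vert\leq cQ^{-w}$ has a solution in integers $q\in\mathbb{Z}$, $\underline{p}\in\mathbb{Z}^m$. The $b$-ary set $\mathcal{S}^{(b)}_{m,\underline{\theta}}(w)\subseteq \mathcal{S}_{m,\underline{\theta}}(w)$ is defined the same way except that $q$ is restricted to powers $q=b^N$ with $N$ a positive integer. $\dim_P$ denotes packing dimension. *)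

theory Defs
  imports "HOL-Analysis.Analysis"
begin

definition is_norm :: "('a::real_vector \<Rightarrow> real) \<Rightarrow> bool" where
  "is_norm \<nu> \<longleftrightarrow>
     (\<forall>x. \<nu> x \<ge> 0) \<and>
     (\<forall>x. \<nu> x = 0 \<longleftrightarrow> x = 0) \<and>
     (\<forall>a x. \<nu> (a *\<^sub>R x) = \<bar>a\<bar> * \<nu> x) \<and>
     (\<forall>x y. \<nu> (x + y) \<le> \<nu> x + \<nu> y)"

text \<open>
  Uniform inhomogeneous approximation of exponent \<open>w\<close> with respect to the norm \<open>\<nu>\<close>, where
  the denominators \<open>q\<close> are restricted to \<open>D\<close>. The parameter \<open>Q\<close> is real.
\<close>

definition uniform_approx_set ::
    "int set \<Rightarrow> (real^'m \<Rightarrow> real) \<Rightarrow> real^'m \<Rightarrow> real \<Rightarrow> (real^'m) set" where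
  "uniform_approx_set D \<nu> \<theta> w =
     {x. \<forall>c>0. \<exists>Q0::real. \<forall>Q\<ge>Q0. \<exists>q\<in>D. \<exists>p::int^'m.
           1 \<le> q \<and> real_of_int q \<le> Q \<and>
           \<nu> (real_of_int q *\<^sub>R x - (\<chi> i. real_of_int (p $ i)) - \<theta>) \<le> c * Q powr (- w)}"

definition singular_set :: "(real^'m \<Rightarrow> real) \<Rightarrow> real^'m \<Rightarrow> real \<Rightarrow> (real^'m) set" where
  "singular_set \<nu> \<theta> w = uniform_approx_set UNIV \<nu> \<theta> w"

definition b_ary_singular_set ::
    "int \<Rightarrow> (real^'m \<Rightarrow> real) \<Rightarrow> real^'m \<Rightarrow> real \<Rightarrow> (real^'m) set" where
  "b_ary_singular_set b \<nu> \<theta> w = uniform_approx_set {b ^ N | N::nat. N \<ge> 1} \<nu> \<theta> w"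

definition affine_hyperplane :: "'a::euclidean_space set \<Rightarrow> bool" where
  "affine_hyperplane H \<longleftrightarrow> (\<exists>a \<beta>. a \<noteq> 0 \<and> H = {x. a \<bullet> x = \<beta>})"

text \<open>
  Packing measure and packing dimension, following Tricot. A packing is a countable family of
  pairwise disjoint closed balls with centres in \<open>E\<close>, encoded by pairs (centre, radius).
  A ball of radius \<open>r\<close> contributes \<open>(2 r)\<^sup>s\<close>; in a nonzero Euclidean space \<open>2 r\<close> is its diameter.
\<close>

definition is_packing :: "real \<Rightarrow> 'a::metric_space set \<Rightarrow> ('a \<times> real) set \<Rightarrow> bool" where
  "is_packing \<delta> E B \<longleftrightarrow>
     countable B \<and>
     (\<forall>(x, r)\<in>B. x \<in> E \<and> 0 < r \<and> r \<le> \<delta>) \<and>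
     disjoint_family_on (\<lambda>(x, r). cball x r) B"

definition packing_premeasure_scale :: "real \<Rightarrow> real \<Rightarrow> 'a::metric_space set \<Rightarrow> ennreal" where
  "packing_premeasure_scale s \<delta> E =
     (SUP B\<in>{B. is_packing \<delta> E B}. \<Sum>\<^sub>\<infinity>(x, r)\<in>B. ennreal ((2 * r) powr s))"

text \<open>
  The limit as \<open>\<delta>\<close> decreases to \<open>0\<close> is an infimum, since the quantity is nondecreasing in \<open>\<delta>\<close>.
\<close>

definition packing_premeasure :: "real \<Rightarrow> 'a::metric_space set \<Rightarrow> ennreal" where
  "packing_premeasure s E = (INF \<delta>\<in>{0<..}. packing_premeasure_scale s \<delta> E)"

definition packing_measure :: "real \<Rightarrow> 'a::metric_space set \<Rightarrow> ennreal" where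
  "packing_measure s E =
     (INF A\<in>{A :: nat \<Rightarrow> 'a set. E \<subseteq> (\<Union>i. A i)}. \<Sum>i. packing_premeasure s (A i))"

text \<open>With this convention the empty set has packing dimension \<open>0\<close>.\<close>

definition packing_dim :: "'a::metric_space set \<Rightarrow> ereal" where
  "packing_dim E = Inf {ereal s | s. s \<ge> 0 \<and> packing_measure s E = 0}"

end

theory Submission
  imports Defs
begin

text \<open>
  Fix a very rapidly increasing sequence of powers of \<open>b\<close>, and write \<open>B\<close> and \<open>B'\<close> for two consecutive
  terms. If at each level \<open>x\<close> lies within slightly less than \<open>1 / (B * B' powr w)\<close> of the lattice
  \<open>(\<int>\<^sup>m + \<theta>) / B\<close>, then \<open>q = B\<close> serves for all \<open>Q\<close> between \<open>B\<close> and \<open>B'\<close>, so \<open>x\<close> belongs to the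
  \<open>b\<close>-ary set. The nested balls around such lattice points form a tree, in which a ball has about
  \<open>(B' powr (1 - w) / B) ^ m\<close> children, with mutual distances at least \<open>1 / B'\<close>. As \<open>B\<close> is negligible
  compared to \<open>B'\<close>, a set that meets all descendants of some ball has positive packing premeasure in
  every dimension below \<open>(1 - w) m\<close>.

  By a Baire category argument, some member of any countable cover of the \<open>b\<close>-ary set minus \<open>T\<close> is
  such a set: otherwise one could descend along a branch whose limit avoids all members of the
  cover and all hyperplanes, since every ball has a child disjoint from a given hyperplane.
\<close>

section \<open>Comparison of an arbitrary norm with the Euclidean norm\<close>

text \<open>Half of the equivalence of norms, by expansion in the standard basis. It turns Euclidean
  closeness to a lattice point into smallness of \<open>\<nu>\<close>. The summand 1 in the constant
  makes its positivity immediate.\<close>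

lemma is_norm_le_norm:
  fixes \<nu> :: "real^'m \<Rightarrow> real"
  assumes "is_norm \<nu>"
  obtains C where "C > 0" "\<And>x. \<nu> x \<le> C * norm x"
proof -
  have tri: "\<nu> (x + y) \<le> \<nu> x + \<nu> y" and hom: "\<nu> (a *\<^sub>R x) = \<bar>a\<bar> * \<nu> x"
    and nonneg: "\<nu> x \<ge> 0" and zero: "\<nu> 0 = 0" for a x y
    using assms unfolding is_norm_def by auto
  have sum: "\<nu> (sum f I) \<le> (\<Sum>i\<in>I. \<nu> (f i))" if "finite I" for f and I :: "'m set"
    using that
  proof induction
    case (insert i I)
    then show ?case using tri[of "f i" "sum f I"] by simp
  qed (simp add: zero)
  have "\<nu> x \<le> (1 + (\<Sum>i\<in>UNIV. \<nu> (axis i 1))) * norm x" for x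
  proof -
    have "\<nu> x = \<nu> (\<Sum>i\<in>UNIV. (x $ i) *\<^sub>R axis i 1)"
      using basis_expansion[of x] by (simp add: scalar_mult_eq_scaleR)
    also have "\<dots> \<le> (\<Sum>i\<in>UNIV. \<bar>x $ i\<bar> * \<nu> (axis i 1))"
      using sum[of UNIV "\<lambda>i. (x $ i) *\<^sub>R axis i 1"] by (simp add: hom)
    also have "\<dots> \<le> (\<Sum>i\<in>UNIV. norm x * \<nu> (axis i 1))"
      by (intro sum_mono mult_right_mono component_le_norm_cart nonneg)
    also have "\<dots> \<le> (1 + (\<Sum>i\<in>UNIV. \<nu> (axis i 1))) * norm x"
      by (simp add: algebra_simps sum_distrib_left)
    finally show ?thesis .
  qed
  moreover have "1 + (\<Sum>i\<in>UNIV. \<nu> (axis i 1)) > 0"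
    by (intro add_pos_nonneg sum_nonneg nonneg) simp
  ultimately show thesis using that by blast
qed

section \<open>Packing dimension\<close>

lemma packing_measure_mono:
  assumes "E \<subseteq> F"
  shows "packing_measure s E \<le> packing_measure s F"
  unfolding packing_measure_def by (rule INF_superset_mono) (use assms in auto)

lemma packing_dim_mono:
  assumes "E \<subseteq> F"
  shows "packing_dim E \<le> packing_dim F"
proof -
  have "packing_measure s E = 0" if "packing_measure s F = 0" for s
    using packing_measure_mono[OF assms, of s] that by simp
  then show ?thesis
    unfolding packing_dim_def by (intro Inf_superset_mono) blast
qed

text \<open>The dimension is an infimum over all exponents with vanishing measure. Treating every
  \<open>s\<close> below \<open>d\<close> avoids any appeal to monotonicity of the measure in
  \<open>s\<close>.\<close>

lemma packing_dim_geI: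
  assumes "\<And>s. 0 \<le> s \<Longrightarrow> s < d \<Longrightarrow> packing_measure s E \<noteq> 0"
  shows "packing_dim E \<ge> ereal d"
  unfolding packing_dim_def
proof (rule Inf_greatest)
  fix x assume "x \<in> {ereal s |s. 0 \<le> s \<and> packing_measure s E = 0}"
  then obtain s where s: "x = ereal s" "0 \<le> s" "packing_measure s E = 0" by blast
  with assms[of s] have "\<not> s < d" by blast
  with s(1) show "ereal d \<le> x" by simp
qed

text \<open>Packings of \<open>A\<close> need centres in \<open>A\<close>, so each point of
  \<open>F\<close> is moved to a point of \<open>A\<close> at distance at most \<open>r\<close>.
  This shortens mutual distances by at most \<open>2 * r\<close>, and more than
  \<open>2 * \<delta>\<close> is left, so balls of radius \<open>\<delta>\<close> stay
  disjoint.\<close>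

lemma packing_premeasure_scale_ge:
  fixes A :: "'a::metric_space set"
  assumes "finite F" "0 < \<delta>" "\<delta> \<le> \<epsilon>" "2 * r + 2 * \<delta> < d"
    and sep: "\<And>x y. x \<in> F \<Longrightarrow> y \<in> F \<Longrightarrow> x \<noteq> y \<Longrightarrow> d \<le> dist x y"
    and meets: "\<And>y. y \<in> F \<Longrightarrow> cball y r \<inter> A \<noteq> {}"
  shows "ennreal (real (card F) * (2 * \<delta>) powr s) \<le> packing_premeasure_scale s \<epsilon> A"
proof -
  obtain g where g: "\<And>y. y \<in> F \<Longrightarrow> g y \<in> A \<and> dist y (g y) \<le> r"
    using meets by (simp add: disjoint_iff Bex_def) metis
  have far: "2 * \<delta> < dist (g x) (g y)" if "x \<in> F" "y \<in> F" "x \<noteq> y" for x y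
  proof -
    have "d \<le> dist x y" by (rule sep[OF that])
    also have "\<dots> \<le> dist x (g x) + dist (g x) (g y) + dist y (g y)"
      by metric
    also have "\<dots> \<le> 2 * r + dist (g x) (g y)" using g[OF that(1)] g[OF that(2)] by linarith
    finally show ?thesis using assms by linarith
  qed
  \<comment> \<open>Distinct points of \<open>F\<close> give distinct balls, so the packing really
    has \<open>card F\<close> terms.\<close>
  have inj: "inj_on (\<lambda>y. (g y, \<delta>)) F"
  proof (rule inj_onI)
    fix x y assume "x \<in> F" "y \<in> F" "(g x, \<delta>) = (g y, \<delta>)"
    then show "x = y" using far[of x y] \<open>0 < \<delta>\<close> by auto
  qed
  let ?P = "(\<lambda>y. (g y, \<delta>)) ` F"
  have "cball (g x) \<delta> \<inter> cball (g y) \<delta> = {}" if "x \<in> F" "y \<in> F" "g x \<noteq> g y" for x y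
  proof -
    have "2 * \<delta> < dist (g x) (g y)" using far that by metis
    moreover have "dist (g x) (g y) \<le> 2 * \<delta>" if "dist (g x) z \<le> \<delta>" "dist (g y) z \<le> \<delta>" for z
      using that dist_triangle2[of "g x" "g y" z] by linarith
    ultimately show ?thesis by (fastforce simp: disjoint_iff)
  qed
  then have "is_packing \<epsilon> A ?P"
    unfolding is_packing_def disjoint_family_on_def
    using \<open>finite F\<close> g assms by (auto simp: countable_finite)
  then have "(\<Sum>\<^sub>\<infinity>(x, r)\<in>?P. ennreal ((2 * r) powr s)) \<le> packing_premeasure_scale s \<epsilon> A"
    unfolding packing_premeasure_scale_def by (intro SUP_upper) simp
  moreover have "(\<Sum>\<^sub>\<infinity>(x, r)\<in>?P. ennreal ((2 * r) powr s)) = ennreal (real (card F) * (2 * \<delta>) powr s)"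
    using \<open>finite F\<close> inj by (simp add: sum.reindex ennreal_mult ennreal_of_nat_eq_real_of_nat)
  ultimately show ?thesis by simp
qed

section \<open>Shifted lattices\<close>

text \<open>The exact solutions \<open>x\<close> of \<open>B *\<^sub>R x - p - \<theta> = 0\<close>,
  around which denominator \<open>B\<close> approximates well.\<close>

definition shifted_lattice_point :: "real^'m \<Rightarrow> real \<Rightarrow> ('m \<Rightarrow> int) \<Rightarrow> real^'m" where
  "shifted_lattice_point \<theta> B p = (1 / B) *\<^sub>R ((\<chi> i. real_of_int (p i)) + \<theta>)"

lemma shifted_lattice_point_nth [simp]:
  "shifted_lattice_point \<theta> B p $ i = (real_of_int (p i) + \<theta> $ i) / B"
  by (simp add: shifted_lattice_point_def)

lemma shifted_lattice_separated:
  assumes "B > 0" "shifted_lattice_point \<theta> B p \<noteq> shifted_lattice_point \<theta> B q"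
  shows "1 / B \<le> dist (shifted_lattice_point \<theta> B p) (shifted_lattice_point \<theta> B q)"
proof -
  obtain i where i: "p i \<noteq> q i" using assms by (auto simp: vec_eq_iff)
  then have "1 \<le> \<bar>real_of_int (p i) - real_of_int (q i)\<bar>" by linarith
  then have "1 / B \<le> \<bar>real_of_int (p i) - real_of_int (q i)\<bar> / B"
    using \<open>B > 0\<close> by (simp add: divide_right_mono)
  also have "\<dots> = dist (shifted_lattice_point \<theta> B p $ i) (shifted_lattice_point \<theta> B q $ i)"
    using \<open>B > 0\<close> by (simp add: dist_real_def diff_divide_distrib[symmetric])
  finally show ?thesis using dist_vec_nth_le order_trans by blast
qed

text \<open>Rounding up \<open>B * c - \<theta>\<close> coordinatewise gives a corner with offsets
  in [0,1). A step \<open>f i \<le> n - 1\<close> keeps each coordinate within \<open>n / B\<close>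
  of \<open>c\<close>, and the l1 norm bounds the Euclidean one. Used with \<open>n = 1\<close> for
  existence, \<open>n = 2\<close> for hyperplanes and large \<open>n\<close> for counting.\<close>

lemma lattice_box_in_cball:
  fixes c \<theta> :: "real^'m"
  assumes "B > 0" "real CARD('m) * real n \<le> \<rho> * B"
  obtains q :: "'m \<Rightarrow> int" where
    "\<And>f. (\<And>i. f i < n) \<Longrightarrow> shifted_lattice_point \<theta> B (\<lambda>i. q i + int (f i)) \<in> cball c \<rho>"
proof -
  define q where "q i = \<lceil>B * c $ i - \<theta> $ i\<rceil>" for i
  have "shifted_lattice_point \<theta> B (\<lambda>i. q i + int (f i)) \<in> cball c \<rho>" if f: "\<And>i. f i < n" for f
  proof -
    let ?y = "shifted_lattice_point \<theta> B (\<lambda>i. q i + int (f i))"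
    have "\<bar>(?y - c) $ i\<bar> \<le> real n / B" for i
    proof -
      have "real (f i) + 1 \<le> real n" using f[of i] by linarith
      then have "\<bar>real_of_int (q i + int (f i)) + \<theta> $ i - B * c $ i\<bar> \<le> real n"
        unfolding q_def by linarith
      moreover have "(?y - c) $ i = (real_of_int (q i + int (f i)) + \<theta> $ i - B * c $ i) / B"
        using \<open>B > 0\<close> by (simp add: field_simps)
      ultimately show ?thesis
        using \<open>B > 0\<close> by (simp add: divide_right_mono del: of_int_add)
    qed
    then have "norm (?y - c) \<le> (\<Sum>i\<in>(UNIV::'m set). real n / B)"
      by (intro order_trans[OF norm_le_l1_cart] sum_mono)
    also have "\<dots> \<le> \<rho>" using assms by (simp add: pos_divide_le_eq)
    finally show ?thesis by (simp add: dist_norm norm_minus_commute)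
  qed
  then show thesis using that by blast
qed

lemma many_lattice_points_in_cball:
  fixes c \<theta> :: "real^'m"
  assumes "B > 0" "real CARD('m) \<le> \<rho> * B"
  obtains F where "finite F" "F \<subseteq> range (shifted_lattice_point \<theta> B) \<inter> cball c \<rho>"
    "(\<rho> * B / (2 * real CARD('m))) ^ CARD('m) \<le> real (card F)"
proof -
  define n where "n = nat \<lfloor>\<rho> * B / real CARD('m)\<rfloor>"
  have ge1: "\<rho> * B / real CARD('m) \<ge> 1" using assms by simp
  \<comment> \<open>Rounding a number that is at least 1 down to an integer loses at most a factor
    2, whence the 2 in the count.\<close>
  moreover have "x / 2 \<le> real (nat \<lfloor>x\<rfloor>)" "real (nat \<lfloor>x\<rfloor>) \<le> x" if "1 \<le> x" for x :: real
  proof -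
    have "real (nat \<lfloor>x\<rfloor>) = real_of_int \<lfloor>x\<rfloor>" "1 \<le> \<lfloor>x\<rfloor>" using that by simp_all
    then show "x / 2 \<le> real (nat \<lfloor>x\<rfloor>)" "real (nat \<lfloor>x\<rfloor>) \<le> x" by linarith+
  qed
  ultimately have n: "real n \<le> \<rho> * B / real CARD('m)" "\<rho> * B / real CARD('m) / 2 \<le> real n"
    unfolding n_def by blast+
  then have "real CARD('m) * real n \<le> \<rho> * B" by (simp add: field_simps)
  then obtain q :: "'m \<Rightarrow> int" where q:
    "\<And>f. (\<And>i. f i < n) \<Longrightarrow> shifted_lattice_point \<theta> B (\<lambda>i. q i + int (f i)) \<in> cball c \<rho>"
    using lattice_box_in_cball[OF \<open>B > 0\<close>] by blast
  let ?X = "PiE (UNIV :: 'm set) (\<lambda>_. {..<n})"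
  let ?F = "(\<lambda>f. shifted_lattice_point \<theta> B (\<lambda>i. q i + int (f i))) ` ?X"
  have "inj_on (\<lambda>f. shifted_lattice_point \<theta> B (\<lambda>i. q i + int (f i))) ?X"
    using \<open>B > 0\<close> by (auto simp: inj_on_def vec_eq_iff fun_eq_iff)
  then have "card ?F = n ^ CARD('m)"
    by (simp add: card_image card_PiE)
  moreover have "(\<rho> * B / (2 * real CARD('m))) ^ CARD('m) \<le> real n ^ CARD('m)"
    using n ge1 by (intro power_mono) (auto simp: field_simps)
  ultimately have "(\<rho> * B / (2 * real CARD('m))) ^ CARD('m) \<le> real (card ?F)" by simp
  moreover have "?F \<subseteq> range (shifted_lattice_point \<theta> B) \<inter> cball c \<rho>"
    using q by (auto simp: PiE_def Pi_def)
  moreover have "finite ?F" by (intro finite_imageI finite_PiE) auto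
  ultimately show thesis using that by blast
qed

text \<open>A hyperplane cannot pass close to a lattice point and to all its neighbours in the
  coordinate directions: every coordinate of the normal \<open>a\<close> would be at most
  \<open>2 * r * B * norm a\<close>, and summing them would give
  \<open>norm a < norm a\<close>.\<close>

lemma lattice_cball_avoids_hyperplane:
  fixes c \<theta> :: "real^'m"
  assumes "affine_hyperplane H" "B > 0" "2 * real CARD('m) \<le> \<rho> * B" "2 * real CARD('m) * (r * B) < 1"
  obtains y where "y \<in> range (shifted_lattice_point \<theta> B) \<inter> cball c \<rho>" "cball y r \<inter> H = {}"
proof -
  obtain a \<beta> where a: "a \<noteq> 0" and H: "H = {x. a \<bullet> x = \<beta>}"
    using assms unfolding affine_hyperplane_def by blast
  have "real CARD('m) * real 2 \<le> \<rho> * B" using assms by simp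
  then obtain q :: "'m \<Rightarrow> int" where q:
    "\<And>f. (\<And>i. f i < 2) \<Longrightarrow> shifted_lattice_point \<theta> B (\<lambda>i. q i + int (f i)) \<in> cball c \<rho>"
    using lattice_box_in_cball[OF \<open>B > 0\<close>] by blast
  define y where "y f = shifted_lattice_point \<theta> B (\<lambda>i. q i + int (f i))" for f :: "'m \<Rightarrow> nat"
  define e where "e i = (\<lambda>j. if j = i then 1 else 0 :: nat)" for i :: 'm
  have "\<exists>f. (\<forall>i. f i < 2) \<and> cball (y f) r \<inter> H = {}"
  proof (rule ccontr)
    assume "\<not> ?thesis"
    then have meets: "\<exists>x. dist (y f) x \<le> r \<and> a \<bullet> x = \<beta>" if "\<And>i. f i < 2" for f
      using that unfolding H by (auto simp: disjoint_iff)
    obtain x0 where x0: "dist (y (\<lambda>_. 0)) x0 \<le> r" "a \<bullet> x0 = \<beta>"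
      using meets[of "\<lambda>_. 0"] by auto
    have "\<bar>a $ i\<bar> \<le> norm a * (2 * r * B)" for i
    proof -
      have "e i j < 2" for j by (simp add: e_def)
      from meets[of "e i", OF this] obtain x where x: "dist (y (e i)) x \<le> r" "a \<bullet> x = \<beta>"
        by blast
      have yd: "y (e i) - y (\<lambda>_. 0) = (1 / B) *\<^sub>R axis i 1"
        using \<open>B > 0\<close> by (auto simp: y_def e_def vec_eq_iff axis_def field_simps)
      have "a $ i / B = a \<bullet> (y (e i) - y (\<lambda>_. 0))"
        unfolding yd by (simp add: inner_axis)
      \<comment> \<open>Both \<open>x\<close> and \<open>x0\<close> lie on \<open>H\<close>, so
        \<open>a\<close> is orthogonal to \<open>x - x0\<close>. What remains are two displacements
        of length at most \<open>r\<close>.\<close>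
      also have "\<dots> = a \<bullet> ((y (e i) - x) - (y (\<lambda>_. 0) - x0))"
        using x x0 by (simp add: inner_diff_right)
      finally have "\<bar>a $ i / B\<bar> \<le> norm a * norm ((y (e i) - x) - (y (\<lambda>_. 0) - x0))"
        using Cauchy_Schwarz_ineq2 by metis
      also have "\<dots> \<le> norm a * (r + r)"
        using x x0 norm_triangle_ineq4[of "y (e i) - x" "y (\<lambda>_. 0) - x0"]
        by (intro mult_left_mono) (auto simp: dist_norm)
      finally show ?thesis using \<open>B > 0\<close> by (simp add: field_simps)
    qed
    then have "norm a \<le> (\<Sum>i\<in>(UNIV::'m set). norm a * (2 * r * B))"
      by (intro order_trans[OF norm_le_l1_cart] sum_mono)
    also have "\<dots> = norm a * (2 * real CARD('m) * (r * B))" by simp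
    also have "\<dots> < norm a * 1"
      using assms a by (intro mult_strict_left_mono) auto
    finally show False by simp
  qed
  then show thesis using q that unfolding y_def by blast
qed

section \<open>A tree of lattice balls\<close>

text \<open>\<open>small\<close> keeps balls of one level well apart compared with the spacing
  \<open>1 / B k\<close>; \<open>large\<close> makes the next lattice fine inside each ball. The
  factor 4 in \<open>large\<close> allows for halving the radius and for two lattice points per
  direction.\<close>

locale lattice_ball_tree =
  fixes \<theta> :: "real^'m" and B r :: "nat \<Rightarrow> real"
  assumes B_pos: "B k > 0"
    and r_pos: "r k > 0"
    and small: "4 * real CARD('m) * (r k * B k) \<le> 1"
    and large: "4 * real CARD('m) \<le> r k * B (Suc k)"
begin

text \<open>A node is a level with a centre, since the level determines both lattice and radius.
  Inclusion of whole balls makes branches nested sequences of compact sets.\<close>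

definition child :: "nat \<times> (real^'m) \<Rightarrow> nat \<times> (real^'m) \<Rightarrow> bool" where
  "child u v \<longleftrightarrow> fst v = Suc (fst u) \<and> snd v \<in> range (shifted_lattice_point \<theta> (B (fst v))) \<and>
     cball (snd v) (r (fst v)) \<subseteq> cball (snd u) (r (fst u))"

abbreviation node_ball :: "nat \<times> (real^'m) \<Rightarrow> (real^'m) set" where
  "node_ball u \<equiv> cball (snd u) (r (fst u))"

lemma card_ge_1: "1 \<le> real CARD('m)"
  using zero_less_card_finite[where 'a='m] by linarith

lemma small': "r k * B k \<le> 1 / 4"
proof -
  have "r k * B k * 1 \<le> r k * B k * real CARD('m)"
    using B_pos r_pos card_ge_1 by (intro mult_left_mono) (auto intro: less_imp_le)
  then show ?thesis using small[of k] by (simp add: algebra_simps)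
qed

text \<open>After multiplication by \<open>B (Suc k)\<close> the left side is at most 1/2 and the
  right side at least 4. Hence a lattice point in the concentric ball of half radius has its whole
  ball inside the parent.\<close>

lemma r_Suc: "2 * r (Suc k) \<le> r k"
proof -
  have "2 * r (Suc k) * B (Suc k) \<le> r k * B (Suc k)"
    using small'[of "Suc k"] large[of k] card_ge_1 by linarith
  then show ?thesis using B_pos mult_le_cancel_right_pos by blast
qed

lemma childI:
  assumes "y \<in> range (shifted_lattice_point \<theta> (B (Suc k))) \<inter> cball c (r k / 2)"
  shows "child (k, c) (Suc k, y)"
proof -
  have "dist c y + r (Suc k) \<le> r k" using assms r_Suc[of k] by simp
  then have "cball y (r (Suc k)) \<subseteq> cball c (r k)"
    by (simp add: cball_subset_cball_iff dist_commute)
  then show ?thesis using assms by (simp add: child_def)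
qed


lemma child_exists: "\<exists>v. child u v"
proof -
  have "real CARD('m) \<le> r (fst u) / 2 * B (Suc (fst u))"
    using large[of "fst u"] card_ge_1 by simp
  then have "real CARD('m) * real 1 \<le> r (fst u) / 2 * B (Suc (fst u))" by simp
  then obtain q where "\<And>f. (\<And>i. f i < 1) \<Longrightarrow>
      shifted_lattice_point \<theta> (B (Suc (fst u))) (\<lambda>i. q i + int (f i)) \<in> cball (snd u) (r (fst u) / 2)"
    using lattice_box_in_cball[OF B_pos] by blast
  from this[of "\<lambda>_. 0"] have "child (fst u, snd u) (Suc (fst u), shifted_lattice_point \<theta> (B (Suc (fst u))) q)"
    by (intro childI) (simp del: mem_cball)
  then show ?thesis by auto
qed

section \<open>Descendants, levels and branches\<close>

lemma descendant_subset:
  assumes "child\<^sup>*\<^sup>* u v"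
  shows "node_ball v \<subseteq> node_ball u"
  using assms by induction (auto simp: child_def simp del: mem_cball)

lemma descendant_level:
  assumes "child\<^sup>*\<^sup>* u v"
  shows "fst u \<le> fst v"
  using assms by induction (auto simp: child_def)

lemma descendant_at_level:
  assumes "fst u \<le> k"
  obtains v where "child\<^sup>*\<^sup>* u v" "fst v = k"
proof -
  have "\<exists>v. child\<^sup>*\<^sup>* u v \<and> fst v = k"
    using assms
  proof (induction k rule: dec_induct)
    case (step k)
    then obtain v where v: "child\<^sup>*\<^sup>* u v" "fst v = k" by blast
    obtain w where "child v w" using child_exists by blast
    with v have "child\<^sup>*\<^sup>* u w" "fst w = Suc k"
      by (meson rtranclp.rtrancl_into_rtrancl, simp add: child_def)
    then show ?case by blast
  qed blast
  then show thesis using that by blast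
qed

text \<open>\<open>child\<close> constrains only the lower node, so the root of a path has to be
  placed on its lattice separately.\<close>

definition is_node :: "nat \<times> (real^'m) \<Rightarrow> bool" where
  "is_node u \<longleftrightarrow> snd u \<in> range (shifted_lattice_point \<theta> (B (fst u)))"

lemma is_node_descendant: "child\<^sup>*\<^sup>* u v \<Longrightarrow> is_node u \<Longrightarrow> is_node v"
  by (induction rule: rtranclp_induct) (auto simp: child_def is_node_def)

text \<open>Paths descend one level at a time and so skip none. The branch constructed below jumps
  over levels, yet its limit must be close to the lattice of each of them.\<close>

lemma intermediate_node:
  assumes "child\<^sup>*\<^sup>* u v" "is_node u" "fst u \<le> k" "k \<le> fst v"
  obtains w where "is_node w" "fst w = k" "node_ball v \<subseteq> node_ball w"
proof -
  have "\<exists>w. is_node w \<and> fst w = k \<and> node_ball v \<subseteq> node_ball w"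
    using assms
  proof (induction rule: rtranclp_induct)
    case base
    then show ?case by (intro exI[of _ u]) auto
  next
    case (step v v')
    show ?case
    proof (cases "k \<le> fst v")
      case True
      then obtain w where "is_node w" "fst w = k" "node_ball v \<subseteq> node_ball w"
        using step by blast
      moreover have "node_ball v' \<subseteq> node_ball v"
        using descendant_subset step(2) by (blast intro: r_into_rtranclp)
      ultimately show ?thesis by blast
    next
      case False
      then have "k = fst v'" using step by (simp add: child_def)
      moreover have "is_node v'" using step(2) unfolding child_def is_node_def by blast
      ultimately show ?thesis by blast
    qed
  qed
  then show thesis using that by blast
qed

text \<open>The Baire category argument: \<open>avoid\<close> says that each member of
  \<open>\<C>\<close> is nowhere dense along the tree. The members are escaped one after another,
  and compactness of the nested balls supplies the limit.\<close>

lemma branch_avoiding: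
  assumes "countable \<C>"
    and avoid: "\<And>C u. C \<in> \<C> \<Longrightarrow> is_node u \<Longrightarrow> \<exists>v. child\<^sup>*\<^sup>* u v \<and> node_ball v \<inter> C = {}"
  obtains x where "x \<notin> \<Union>\<C>" "\<And>k. \<exists>p. dist (shifted_lattice_point \<theta> (B k) p) x \<le> r k"
proof -
  \<comment> \<open>Adding the empty set, which every ball avoids, makes the family nonempty and
    hence enumerable even if \<open>\<C>\<close> is empty.\<close>
  define D where "D = from_nat_into (insert {} \<C>)"
  have D: "\<exists>v. child\<^sup>*\<^sup>* u v \<and> node_ball v \<inter> D n = {}" if "is_node u" for u n
    using avoid[OF _ that] from_nat_into[of "insert {} \<C>" n] unfolding D_def by blast
  have "\<exists>f. \<forall>n. (is_node (f n) \<and> (n = 0 \<longrightarrow> fst (f n) = 0)) \<and>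
      (child\<^sup>*\<^sup>* (f n) (f (Suc n)) \<and> fst (f n) < fst (f (Suc n)) \<and> node_ball (f (Suc n)) \<inter> D n = {})"
  proof (rule dependent_nat_choice)
    show "\<exists>u. is_node u \<and> (0 = (0::nat) \<longrightarrow> fst u = 0)"
      by (intro exI[of _ "(0, shifted_lattice_point \<theta> (B 0) (\<lambda>_. 0))"]) (simp add: is_node_def)
  next
    fix u :: "nat \<times> (real^'m)" and n :: nat
    assume u: "is_node u \<and> (n = 0 \<longrightarrow> fst u = 0)"
    \<comment> \<open>\<open>D\<close> might return the node itself; passing to a child first forces
      the level to increase strictly.\<close>
    obtain v where v: "child u v" using child_exists by blast
    then have "is_node v" using u is_node_descendant by blast
    then obtain w where w: "child\<^sup>*\<^sup>* v w" "node_ball w \<inter> D n = {}" using D by blast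
    have "fst u < fst w" using v descendant_level[OF w(1)] by (simp add: child_def)
    moreover have "child\<^sup>*\<^sup>* u w" using v w by (meson converse_rtranclp_into_rtranclp)
    ultimately show "\<exists>w. (is_node w \<and> (Suc n = 0 \<longrightarrow> fst w = 0)) \<and>
        child\<^sup>*\<^sup>* u w \<and> fst u < fst w \<and> node_ball w \<inter> D n = {}"
      using w u is_node_descendant by blast
  qed
  then obtain f where f: "\<And>n. is_node (f n)" "fst (f 0) = 0" "\<And>n. child\<^sup>*\<^sup>* (f n) (f (Suc n))"
      "\<And>n. fst (f n) < fst (f (Suc n))" "\<And>n. node_ball (f (Suc n)) \<inter> D n = {}"
    by blast
  have path: "child\<^sup>*\<^sup>* (f m) (f n)" if "m \<le> n" for m n
    using that
  proof (induction n rule: dec_induct)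
    case (step n)
    show ?case by (rule rtranclp_trans[OF step.IH f(3)])
  qed blast
  have "\<Inter> (range (\<lambda>n. node_ball (f n))) \<noteq> {}"
  proof (rule compact_nest)
    show "node_ball (f n) \<noteq> {}" for n using r_pos[of "fst (f n)"] by (simp add: less_imp_le not_less)
  qed (use descendant_subset path in auto)
  then obtain x where x: "\<And>n. x \<in> node_ball (f n)" by blast
  have "x \<notin> D n" for n using x[of "Suc n"] f(5)[of n] by blast
  moreover have "range D = insert {} \<C>"
    unfolding D_def using \<open>countable \<C>\<close> by (intro range_from_nat_into) auto
  ultimately have "x \<notin> \<Union>\<C>" by blast
  moreover have "\<exists>p. dist (shifted_lattice_point \<theta> (B k) p) x \<le> r k" for k
  proof -
    \<comment> \<open>The path from \<open>f 0\<close> at level 0 to \<open>f k\<close> at level at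
      least \<open>k\<close> passes through level \<open>k\<close>.\<close>
    have "strict_mono (\<lambda>n. fst (f n))" using f(4) by (simp add: strict_mono_Suc_iff)
    then have "k \<le> fst (f k)" by (rule strict_mono_imp_increasing)
    then obtain w where "is_node w" "fst w = k" "node_ball (f k) \<subseteq> node_ball w"
      using intermediate_node[OF path[of 0 k] f(1), of k] f(2) by auto
    with x[of k] obtain p where "x \<in> cball (shifted_lattice_point \<theta> (B k) p) (r k)"
      unfolding is_node_def by (metis imageE subsetD)
    then show ?thesis by auto
  qed
  ultimately show thesis using that by blast
qed

section \<open>Hyperplanes and packing sums in the tree\<close>

lemma descendant_avoids_hyperplane:
  assumes "affine_hyperplane H"
  shows "\<exists>v. child\<^sup>*\<^sup>* u v \<and> node_ball v \<inter> H = {}"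
proof -
  let ?k = "fst u"
  have "2 * real CARD('m) \<le> r ?k / 2 * B (Suc ?k)" using large[of ?k] by simp
  moreover have "2 * real CARD('m) * (r (Suc ?k) * B (Suc ?k)) < 1"
    using small[of "Suc ?k"] by linarith
  ultimately obtain y where
    y: "y \<in> range (shifted_lattice_point \<theta> (B (Suc ?k))) \<inter> cball (snd u) (r ?k / 2)"
      "cball y (r (Suc ?k)) \<inter> H = {}"
    by (rule lattice_cball_avoids_hyperplane[OF assms B_pos])
  have "child u (Suc ?k, y)" using childI[OF y(1)] by simp
  with y(2) show ?thesis by (intro exI[of _ "(Suc ?k, y)"]) auto
qed

text \<open>\<open>A\<close> meets every child ball of a descendant \<open>w\<close> of
  \<open>u\<close> at a deep level \<open>k\<close>. One point from each gives a packing of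
  \<open>A\<close> with equal radii, whose sum \<open>count\<close> bounds below by 1;
  \<open>unbounded\<close> makes these radii smaller than any \<open>\<epsilon>\<close>.\<close>

lemma packing_premeasure_ge_1:
  assumes meets: "\<And>v. child\<^sup>*\<^sup>* u v \<Longrightarrow> node_ball v \<inter> A \<noteq> {}"
    and unbounded: "filterlim B at_top sequentially"
    and count: "\<forall>\<^sub>F k in sequentially.
      1 \<le> (r k * B (Suc k) / (4 * real CARD('m))) ^ CARD('m) * (1 / (4 * B (Suc k))) powr s"
  shows "1 \<le> packing_premeasure s A"
  unfolding packing_premeasure_def
proof (rule INF_greatest)
  fix \<epsilon> :: real assume "\<epsilon> \<in> {0<..}"
  then have "\<epsilon> > 0" by simp
  have "filterlim (\<lambda>k. B (Suc k)) at_top sequentially"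
    using unbounded by (rule filterlim_compose[OF _ filterlim_Suc])
  then have "\<forall>\<^sub>F k in sequentially. 1 / (8 * \<epsilon>) \<le> B (Suc k)"
    by (simp add: filterlim_at_top)
  moreover have "\<forall>\<^sub>F k in sequentially. fst u \<le> k"
    by (rule eventually_ge_at_top)
  ultimately have "\<forall>\<^sub>F k in sequentially. fst u \<le> k \<and> 1 / (8 * \<epsilon>) \<le> B (Suc k) \<and>
      1 \<le> (r k * B (Suc k) / (4 * real CARD('m))) ^ CARD('m) * (1 / (4 * B (Suc k))) powr s"
    using count by eventually_elim auto
  then obtain k where k: "fst u \<le> k" "1 / (8 * \<epsilon>) \<le> B (Suc k)"
      and one: "1 \<le> (r k * B (Suc k) / (4 * real CARD('m))) ^ CARD('m) * (1 / (4 * B (Suc k))) powr s"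
    using eventually_happens'[OF sequentially_bot] by blast
  obtain w where w: "child\<^sup>*\<^sup>* u w" "fst w = k" using descendant_at_level[OF k(1)] by blast
  have B: "B (Suc k) > 0" by (rule B_pos)
  have "real CARD('m) \<le> r k / 2 * B (Suc k)" using large[of k] card_ge_1 by simp
  then obtain F where F: "finite F"
      "F \<subseteq> range (shifted_lattice_point \<theta> (B (Suc k))) \<inter> cball (snd w) (r k / 2)"
      "(r k / 2 * B (Suc k) / (2 * real CARD('m))) ^ CARD('m) \<le> real (card F)"
    by (rule many_lattice_points_in_cball[OF B])
  have "1 \<le> (r k * B (Suc k) / (4 * real CARD('m))) ^ CARD('m) * (1 / (4 * B (Suc k))) powr s"
    by (rule one)
  \<comment> \<open>The 4 in the base is 2 from the half radius times 2 from rounding; the radius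
    \<open>1 / (8 * B (Suc k))\<close> gives diameter \<open>1 / (4 * B (Suc k))\<close>.\<close>
  also have "\<dots> \<le> real (card F) * (2 * (1 / (8 * B (Suc k)))) powr s"
    using F(3) by (intro mult_mono) (auto simp: mult.commute)
  finally have "1 \<le> ennreal (real (card F) * (2 * (1 / (8 * B (Suc k)))) powr s)"
    by simp
  also have "\<dots> \<le> packing_premeasure_scale s \<epsilon> A"
  proof (rule packing_premeasure_scale_ge[OF F(1)])
    show "0 < 1 / (8 * B (Suc k))" using B by simp
    show "1 / (8 * B (Suc k)) \<le> \<epsilon>" using B k(2) \<open>\<epsilon> > 0\<close> by (simp add: field_simps)
    \<comment> \<open>By \<open>small'\<close> the two terms are at most 1/2 and exactly 1/4 of the
      spacing \<open>1 / B (Suc k)\<close>.\<close>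
    show "2 * r (Suc k) + 2 * (1 / (8 * B (Suc k))) < 1 / B (Suc k)"
      using B small'[of "Suc k"] by (simp add: field_simps)
    show "1 / B (Suc k) \<le> dist x y" if "x \<in> F" "y \<in> F" "x \<noteq> y" for x y
      using shifted_lattice_separated[OF B] F(2) that by blast
    show "cball y (r (Suc k)) \<inter> A \<noteq> {}" if "y \<in> F" for y
    proof -
      have "child (k, snd w) (Suc k, y)" using childI F(2) that by blast
      then have "child w (Suc k, y)" using w(2) by (cases w) simp
      then have "child\<^sup>*\<^sup>* u (Suc k, y)" using w(1) by simp
      from meets[OF this] show ?thesis by simp
    qed
  qed
  finally show "1 \<le> packing_premeasure_scale s \<epsilon> A" .
qed

text \<open>Measure zero would give a cover by sets of premeasure below 1. By the previous bound
  each of them misses a descendant ball of every node, as does each hyperplane, so some branch ends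
  in a point of \<open>E\<close> outside all of them.\<close>

lemma packing_measure_nonzero:
  assumes "countable \<H>" "\<And>H. H \<in> \<H> \<Longrightarrow> affine_hyperplane H"
    and E: "\<And>x. (\<And>k. \<exists>p. dist (shifted_lattice_point \<theta> (B k) p) x \<le> r k) \<Longrightarrow> x \<in> E"
    and unbounded: "filterlim B at_top sequentially"
    and count: "\<forall>\<^sub>F k in sequentially.
      1 \<le> (r k * B (Suc k) / (4 * real CARD('m))) ^ CARD('m) * (1 / (4 * B (Suc k))) powr s"
  shows "packing_measure s (E - \<Union>\<H>) \<noteq> 0"
proof
  assume "packing_measure s (E - \<Union>\<H>) = 0"
  then have "(INF A\<in>{A :: nat \<Rightarrow> _. E - \<Union>\<H> \<subseteq> (\<Union>i. A i)}. \<Sum>i. packing_premeasure s (A i)) < 1"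
    unfolding packing_measure_def by simp
  then obtain A :: "nat \<Rightarrow> (real^'m) set" where A: "E - \<Union>\<H> \<subseteq> (\<Union>i. A i)"
      "(\<Sum>i. packing_premeasure s (A i)) < 1"
    unfolding INF_less_iff by blast
  have lt1: "packing_premeasure s (A i) < 1" for i
    using sum_le_suminf[of "\<lambda>i. packing_premeasure s (A i)" "{i}"] A(2) by simp
  have "\<exists>v. child\<^sup>*\<^sup>* u v \<and> node_ball v \<inter> C = {}" if "C \<in> \<H> \<union> range A" for C u
    using that
  proof
    assume "C \<in> \<H>"
    then show ?thesis using assms(2) descendant_avoids_hyperplane by blast
  next
    assume "C \<in> range A"
    then have "packing_premeasure s C < 1" using lt1 by blast
    then show ?thesis
      using packing_premeasure_ge_1[OF _ unbounded count, of u C] by (meson linorder_not_le)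
  qed
  moreover have "countable (\<H> \<union> range A)" using \<open>countable \<H>\<close> by simp
  ultimately obtain x where "x \<notin> \<Union>(\<H> \<union> range A)"
      "\<And>k. \<exists>p. dist (shifted_lattice_point \<theta> (B k) p) x \<le> r k"
    using branch_avoiding[of "\<H> \<union> range A" thesis] by blast
  with E A(1) show False by blast
qed

end

section \<open>Choice of the scales\<close>

text \<open>
  The exponents are chosen so that \<open>level_scale \<beta> (Suc k)\<close> is the power with exponent \<open>k + 2\<close> of
  \<open>\<beta> ^ k * level_scale \<beta> k\<close>. The factor \<open>\<beta> ^ k\<close> in the radius is what eventually beats every
  constant \<open>c > 0\<close> in the definition of the singular set.
\<close>

primrec level_exponent :: "nat \<Rightarrow> nat" where
  "level_exponent 0 = 1"
| "level_exponent (Suc k) = (k + 2) * (k + level_exponent k)"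

definition level_scale :: "real \<Rightarrow> nat \<Rightarrow> real" where
  "level_scale \<beta> k = \<beta> ^ level_exponent k"

definition level_radius :: "real \<Rightarrow> real \<Rightarrow> nat \<Rightarrow> real" where
  "level_radius \<beta> w k = 1 / (\<beta> ^ k * level_scale \<beta> k * level_scale \<beta> (Suc k) powr w)"

text \<open>The \<open>b\<close>-ary set admits only exponents \<open>N \<ge> 1\<close>.\<close>

lemma level_exponent_ge_1: "1 \<le> level_exponent k"
  by (induction k) auto

context
  fixes \<beta> :: real
  assumes \<beta>: "2 \<le> \<beta>"
begin

lemma level_scale_pos: "level_scale \<beta> k > 0"
  using \<beta> by (simp add: level_scale_def)

lemma level_radius_pos: "level_radius \<beta> w k > 0"
  using \<beta> level_scale_pos[of k] level_scale_pos[of "Suc k"] by (simp add: level_radius_def)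

text \<open>The product on the right, later \<open>?M\<close>, is the base in whose powers the main
  estimates are expressed; this makes it unbounded.\<close>

lemma two_power_le: "2 ^ k \<le> \<beta> ^ k * level_scale \<beta> k"
proof -
  have "2 ^ k * 1 \<le> \<beta> ^ k * level_scale \<beta> k"
    using \<beta> by (intro mult_mono power_mono) (auto simp: level_scale_def)
  then show ?thesis by simp
qed

lemma level_scale_Suc: "level_scale \<beta> (Suc k) = (\<beta> ^ k * level_scale \<beta> k) powr (real k + 2)"
proof -
  have "level_scale \<beta> (Suc k) = (\<beta> ^ k * level_scale \<beta> k) ^ (k + 2)"
    by (simp add: level_scale_def power_add[symmetric] power_mult[symmetric] mult.commute del: power_Suc)
  also have "\<dots> = (\<beta> ^ k * level_scale \<beta> k) powr real (k + 2)"
    using \<beta> level_scale_pos[of k] by (intro powr_realpow[symmetric]) simp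
  also have "real (k + 2) = real k + 2" by simp
  finally show ?thesis .
qed

lemma level_scale_at_top: "filterlim (level_scale \<beta>) at_top sequentially"
proof -
  have "real k \<le> level_scale \<beta> (Suc k)" for k
  proof -
    let ?M = "\<beta> ^ k * level_scale \<beta> k"
    have "real k \<le> 2 ^ k" by (rule less_imp_le[OF of_nat_less_two_power])
    then have k: "real k \<le> ?M" using two_power_le[of k] by linarith
    have "1 \<le> (2::real) ^ k" by simp
    then have "1 \<le> ?M" using two_power_le[of k] by linarith
    then have "?M powr 1 \<le> ?M powr (real k + 2)" by (intro powr_mono) auto
    with k \<open>1 \<le> ?M\<close> show ?thesis by (simp add: level_scale_Suc)
  qed
  then have "filterlim (\<lambda>k. level_scale \<beta> (Suc k)) at_top sequentially"
    by (intro filterlim_at_top_mono[OF filterlim_real_sequentially]) auto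
  then show ?thesis by (simp add: filterlim_sequentially_Suc)
qed

text \<open>For large \<open>k\<close> the exponent is at least 1, and the base is at least
  \<open>2 ^ k\<close>, which exceeds \<open>k\<close> and hence \<open>K\<close>.\<close>

lemma eventually_powr_ge:
  assumes "\<alpha> > 0"
  shows "\<forall>\<^sub>F k in sequentially. K \<le> (\<beta> ^ k * level_scale \<beta> k) powr ((real k + 2) * \<alpha> - \<gamma>)"
proof -
  have "\<forall>\<^sub>F k in sequentially. max K ((\<gamma> + 1) / \<alpha>) \<le> real k"
    using filterlim_real_sequentially unfolding filterlim_at_top by blast
  then show ?thesis
  proof eventually_elim
    case (elim k)
    let ?M = "\<beta> ^ k * level_scale \<beta> k"
    have "real k \<le> 2 ^ k" by (rule less_imp_le[OF of_nat_less_two_power])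
    moreover have "K \<le> real k" using elim by simp
    ultimately have k: "K \<le> ?M" using two_power_le[of k] by linarith
    have "1 \<le> (2::real) ^ k" by simp
    then have "1 \<le> ?M" using two_power_le[of k] by linarith
    have "\<gamma> + 1 \<le> real k * \<alpha>" using elim assms by (simp add: pos_divide_le_eq)
    then have "1 \<le> (real k + 2) * \<alpha> - \<gamma>" using assms by (simp add: algebra_simps)
    then have "?M powr 1 \<le> ?M powr ((real k + 2) * \<alpha> - \<gamma>)"
      using \<open>1 \<le> ?M\<close> by (intro powr_mono) auto
    with k \<open>1 \<le> ?M\<close> show ?case by simp
  qed
qed

section \<open>Radii compared with scales, and the packing count\<close>

lemma radius_times_scale: "level_radius \<beta> w k * level_scale \<beta> k = 1 / \<beta> ^ k * level_scale \<beta> (Suc k) powr (- w)"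
  using level_scale_pos[of k] by (simp add: level_radius_def powr_minus_divide)

text \<open>The factor \<open>\<beta> ^ k\<close> in the radius forces decay even for
  \<open>w = 0\<close>; this yields \<open>small\<close> from some level on.\<close>

lemma radius_times_scale_le:
  assumes "w \<ge> 0"
  shows "level_radius \<beta> w k * level_scale \<beta> k \<le> (1 / 2) ^ k"
proof -
  have "1 / \<beta> ^ k \<le> (1 / 2) ^ k"
    using \<beta> by (simp add: power_divide frac_le power_mono)
  moreover have "1 \<le> level_scale \<beta> (Suc k)" unfolding level_scale_def using \<beta> by (intro one_le_power) simp
  then have "level_scale \<beta> (Suc k) powr (- w) \<le> 1"
    using powr_mono[of "- w" 0 "level_scale \<beta> (Suc k)"] \<open>w \<ge> 0\<close> by simp
  ultimately have "1 / \<beta> ^ k * level_scale \<beta> (Suc k) powr (- w) \<le> (1 / 2) ^ k * 1"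
    using \<beta> by (intro mult_mono) auto
  then show ?thesis by (simp add: radius_times_scale)
qed

lemma radius_times_scale_Suc:
  "level_radius \<beta> w k * level_scale \<beta> (Suc k) = (\<beta> ^ k * level_scale \<beta> k) powr ((real k + 2) * (1 - w) - 1)"
proof -
  let ?M = "\<beta> ^ k * level_scale \<beta> k"
  have "?M > 0" using \<beta> level_scale_pos[of k] by simp
  have "level_radius \<beta> w k * level_scale \<beta> (Suc k) = ?M powr (real k + 2) / (?M powr 1 * ?M powr ((real k + 2) * w))"
    unfolding level_radius_def level_scale_Suc powr_powr using \<open>?M > 0\<close> by simp
  also have "\<dots> = ?M powr (real k + 2 - (1 + (real k + 2) * w))"
    by (simp only: powr_diff powr_add)
  also have "real k + 2 - (1 + (real k + 2) * w) = (real k + 2) * (1 - w) - 1"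
    by (simp add: algebra_simps)
  finally show ?thesis .
qed

text \<open>Up to constants the product is \<open>?M\<close> to the power
  \<open>(k + 2) * ((1 - w) * m - s) - m\<close>. The condition on \<open>s\<close> makes the
  coefficient of \<open>k\<close> positive, so every constant is beaten.\<close>

lemma eventually_count:
  assumes "s < (1 - w) * real m" "m > 0"
  shows "\<forall>\<^sub>F k in sequentially.
    1 \<le> (level_radius \<beta> w k * level_scale \<beta> (Suc k) / (4 * real m)) ^ m * (1 / (4 * level_scale \<beta> (Suc k))) powr s"
proof -
  \<comment> \<open>Collects the constants: \<open>(4 * m) ^ m\<close> from the number of balls,
    \<open>4 powr s\<close> from their size.\<close>
  let ?K = "(4 * real m) ^ m * 4 powr s"
  have "\<forall>\<^sub>F k in sequentially.
      ?K \<le> (\<beta> ^ k * level_scale \<beta> k) powr ((real k + 2) * ((1 - w) * real m - s) - real m)"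
    using assms by (intro eventually_powr_ge) simp
  then show ?thesis
  proof eventually_elim
    case (elim k)
    let ?M = "\<beta> ^ k * level_scale \<beta> k"
    let ?e = "(real k + 2) * (1 - w) - 1"
    have "?M > 0" using \<beta> level_scale_pos[of k] by simp
    then have "(level_radius \<beta> w k * level_scale \<beta> (Suc k)) ^ m = ?M powr (?e * real m)"
      unfolding radius_times_scale_Suc powr_powr[symmetric] using \<beta> by (subst powr_realpow) auto
    moreover have "level_scale \<beta> (Suc k) powr s = ?M powr ((real k + 2) * s)"
      by (simp add: level_scale_Suc powr_powr)
    ultimately have "(level_radius \<beta> w k * level_scale \<beta> (Suc k) / (4 * real m)) ^ m * (1 / (4 * level_scale \<beta> (Suc k))) powr s
        = ?M powr (?e * real m) / ?M powr ((real k + 2) * s) / ?K"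
      using level_scale_pos[of "Suc k"] by (simp add: power_divide powr_divide powr_mult)
    also have "?M powr (?e * real m) / ?M powr ((real k + 2) * s) = ?M powr (?e * real m - (real k + 2) * s)"
      by (simp add: powr_diff)
    also have "?e * real m - (real k + 2) * s = (real k + 2) * ((1 - w) * real m - s) - real m"
      by (simp add: algebra_simps)
    finally show ?case using elim \<open>m > 0\<close> by simp
  qed
qed

end

section \<open>The packing dimension of the singular sets\<close>

text \<open>For \<open>Q\<close> between two consecutive scales take the smaller one as
  \<open>q\<close>. The larger one enters the radius with exponent \<open>- w\<close>, which gives
  at most \<open>Q powr (- w)\<close>; the remaining factor \<open>1 / b ^ k\<close> falls below
  \<open>c / C\<close>.\<close>

lemma b_ary_singularI:
  fixes x :: "real^'m"
  assumes \<nu>: "\<And>x. \<nu> x \<le> C * norm x" and "C > 0" and b: "b \<ge> 2" and "w \<ge> 0"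
    and near: "\<And>k. k \<ge> k0 \<Longrightarrow>
      \<exists>p. dist (shifted_lattice_point \<theta> (level_scale (real_of_int b) k) p) x \<le> level_radius (real_of_int b) w k"
  shows "x \<in> b_ary_singular_set b \<nu> \<theta> w"
  unfolding b_ary_singular_set_def uniform_approx_set_def
proof (intro CollectI allI impI)
  let ?B = "level_scale (real_of_int b)"
  have \<beta>: "2 \<le> real_of_int b" using b by simp
  fix c :: real assume "c > 0"
  have "\<forall>\<^sub>F k in sequentially. (1 / 2 :: real) ^ k < c / C"
    using \<open>c > 0\<close> \<open>C > 0\<close> by (intro order_tendstoD(2)[OF LIMSEQ_power_zero]) auto
  then obtain k1 where k1: "\<And>k. k \<ge> k1 \<Longrightarrow> (1 / 2 :: real) ^ k < c / C" "k1 \<ge> k0"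
    unfolding eventually_sequentially by (metis max.bounded_iff max.cobounded2)
  show "\<exists>Q0::real. \<forall>Q\<ge>Q0. \<exists>q\<in>{b ^ N |N. 1 \<le> N}. \<exists>p::int^'m. 1 \<le> q \<and> real_of_int q \<le> Q \<and>
      \<nu> (real_of_int q *\<^sub>R x - (\<chi> i. real_of_int (p $ i)) - \<theta>) \<le> c * Q powr - w"
  proof (intro exI[of _ "?B k1"] allI impI)
    fix Q assume Q: "?B k1 \<le> Q"
    have "\<forall>\<^sub>F n in sequentially. Q < ?B n"
      using level_scale_at_top[OF \<beta>] unfolding filterlim_at_top_dense by blast
    then obtain n where n: "n \<ge> k1" "Q < ?B n"
      unfolding eventually_sequentially by (metis max.cobounded1 max.cobounded2)
    \<comment> \<open>Otherwise induction from \<open>k1\<close> would keep all later scales below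
      \<open>Q\<close>, although they tend to infinity.\<close>
    have "\<exists>k\<ge>k1. ?B k \<le> Q \<and> Q < ?B (Suc k)"
    proof (rule ccontr)
      assume "\<not> ?thesis"
      then have step: "?B k \<le> Q \<Longrightarrow> ?B (Suc k) \<le> Q" if "k1 \<le> k" for k
        using that by (meson linorder_not_le)
      have "?B n \<le> Q" using n(1) by (induction rule: dec_induct) (use Q step in auto)
      with n(2) show False by simp
    qed
    then obtain k where k: "k \<ge> k1" "?B k \<le> Q" "Q < ?B (Suc k)" by blast
    have pos: "?B k > 0" by (rule level_scale_pos[OF \<beta>])
    obtain p where p: "dist (shifted_lattice_point \<theta> (?B k) p) x \<le> level_radius (real_of_int b) w k"
      using near[of k] k(1) k1(2) by auto
    have eq: "?B k *\<^sub>R x - (\<chi> i. real_of_int ((\<chi> i. p i) $ i)) - \<theta>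
        = ?B k *\<^sub>R (x - shifted_lattice_point \<theta> (?B k) p)"
      using pos by (simp add: vec_eq_iff right_diff_distrib)
    have "\<nu> (?B k *\<^sub>R (x - shifted_lattice_point \<theta> (?B k) p))
        \<le> C * norm (?B k *\<^sub>R (x - shifted_lattice_point \<theta> (?B k) p))"
      by (rule \<nu>)
    also have "\<dots> = C * (?B k * dist (shifted_lattice_point \<theta> (?B k) p) x)"
      using pos by (simp add: dist_norm norm_minus_commute)
    also have "\<dots> \<le> C * (level_radius (real_of_int b) w k * ?B k)"
      using p pos \<open>C > 0\<close> by simp
    also have "\<dots> = C * (1 / real_of_int b ^ k * ?B (Suc k) powr (- w))"
      by (simp add: radius_times_scale[OF \<beta>])
    also have "\<dots> \<le> C * (c / C * Q powr (- w))"
    proof (intro mult_left_mono mult_mono)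
      have "1 / real_of_int b ^ k \<le> (1 / 2) ^ k"
        using \<beta> by (simp add: power_divide frac_le power_mono)
      then show "1 / real_of_int b ^ k \<le> c / C" using k1(1)[OF k(1)] by linarith
      show "?B (Suc k) powr (- w) \<le> Q powr (- w)"
        using k pos \<open>w \<ge> 0\<close> by (intro powr_mono2') auto
    qed (use \<open>C > 0\<close> \<open>c > 0\<close> in auto)
    also have "\<dots> = c * Q powr (- w)" using \<open>C > 0\<close> by simp
    finally have "\<nu> (?B k *\<^sub>R x - (\<chi> i. real_of_int ((\<chi> i. p i) $ i)) - \<theta>) \<le> c * Q powr (- w)"
      unfolding eq .
    moreover have "real_of_int (b ^ level_exponent k) = ?B k" by (simp add: level_scale_def)
    moreover have "1 \<le> b ^ level_exponent k" using b by (intro one_le_power) simp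
    ultimately show "\<exists>q\<in>{b ^ N |N. 1 \<le> N}. \<exists>p::int^'m. 1 \<le> q \<and> real_of_int q \<le> Q \<and>
        \<nu> (real_of_int q *\<^sub>R x - (\<chi> i. real_of_int (p $ i)) - \<theta>) \<le> c * Q powr - w"
      using k(2) level_exponent_ge_1
      by (intro bexI[of _ "b ^ level_exponent k"] exI[of _ "\<chi> i. p i"]) auto
  qed
qed

lemma packing_dim_b_ary_singular_ge:
  fixes \<nu> :: "real^'m \<Rightarrow> real"
  assumes "is_norm \<nu>" and b: "b \<ge> 2" and "countable \<H>"
    and \<H>: "\<And>H. H \<in> \<H> \<Longrightarrow> affine_hyperplane H"
    and w: "0 \<le> w" "w < 1"
  shows "packing_dim (b_ary_singular_set b \<nu> \<theta> w - \<Union>\<H>) \<ge> ereal ((1 - w) * real CARD('m))"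
proof (rule packing_dim_geI)
  let ?m = "real CARD('m)"
  let ?B = "level_scale (real_of_int b)" and ?r = "level_radius (real_of_int b) w"
  have \<beta>: "2 \<le> real_of_int b" using b by simp
  obtain C where C: "C > 0" "\<And>x. \<nu> x \<le> C * norm x"
    using is_norm_le_norm[OF assms(1)] by blast
  fix s :: real assume s: "0 \<le> s" "s < (1 - w) * ?m"
  have "\<forall>\<^sub>F k in sequentially. (1 / 2 :: real) ^ k < 1 / (4 * ?m)"
    by (intro order_tendstoD(2)[OF LIMSEQ_power_zero]) auto
  then have "\<forall>\<^sub>F k in sequentially. 4 * ?m * (?r k * ?B k) \<le> 1"
  proof eventually_elim
    case (elim k)
    have "?r k * ?B k \<le> 1 / (4 * ?m)"
      using radius_times_scale_le[OF \<beta> w(1), of k] elim by linarith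
    then show ?case by (simp add: field_simps)
  qed
  moreover have "\<forall>\<^sub>F k in sequentially. 4 * ?m \<le> ?r k * ?B (Suc k)"
    unfolding radius_times_scale_Suc[OF \<beta>] using w by (intro eventually_powr_ge[OF \<beta>]) simp
  ultimately have "\<forall>\<^sub>F k in sequentially.
      4 * ?m * (?r k * ?B k) \<le> 1 \<and> 4 * ?m \<le> ?r k * ?B (Suc k)"
    by (rule eventually_conj)
  then obtain k0 where k0: "\<And>k. k \<ge> k0 \<Longrightarrow> 4 * ?m * (?r k * ?B k) \<le> 1"
      "\<And>k. k \<ge> k0 \<Longrightarrow> 4 * ?m \<le> ?r k * ?B (Suc k)"
    unfolding eventually_sequentially by blast
  \<comment> \<open>The inequalities of the locale hold only from \<open>k0\<close> on, so the tree
    starts at that level.\<close>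
  interpret lattice_ball_tree \<theta> "\<lambda>k. ?B (k + k0)" "\<lambda>k. ?r (k + k0)"
    by unfold_locales (use k0 level_scale_pos[OF \<beta>] level_radius_pos[OF \<beta>] in auto)
  show "packing_measure s (b_ary_singular_set b \<nu> \<theta> w - \<Union>\<H>) \<noteq> 0"
  proof (rule packing_measure_nonzero[OF assms(3) \<H>])
    fix x assume x: "\<And>k. \<exists>p. dist (shifted_lattice_point \<theta> (?B (k + k0)) p) x \<le> ?r (k + k0)"
    show "x \<in> b_ary_singular_set b \<nu> \<theta> w"
    proof (rule b_ary_singularI[OF C(2,1) b w(1)])
      show "\<exists>p. dist (shifted_lattice_point \<theta> (?B k) p) x \<le> ?r k" if "k \<ge> k0" for k
        using x[of "k - k0"] that by simp
    qed
  next
    show "filterlim (\<lambda>k. ?B (k + k0)) at_top sequentially"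
      by (rule filterlim_compose[OF level_scale_at_top[OF \<beta>] filterlim_add_const_nat_at_top])
  next
    have "\<forall>\<^sub>F k in sequentially.
        1 \<le> (?r k * ?B (Suc k) / (4 * ?m)) ^ CARD('m) * (1 / (4 * ?B (Suc k))) powr s"
      using s by (intro eventually_count[OF \<beta>]) auto
    then show "\<forall>\<^sub>F k in sequentially.
        1 \<le> (?r (k + k0) * ?B (Suc k + k0) / (4 * ?m)) ^ CARD('m) * (1 / (4 * ?B (Suc k + k0))) powr s"
      unfolding add_Suc by (subst eventually_sequentially_seg)
  qed auto
qed

lemma b_ary_singular_subset: "b_ary_singular_set b \<nu> \<theta> w \<subseteq> singular_set \<nu> \<theta> w"
  unfolding b_ary_singular_set_def singular_set_def uniform_approx_set_def by blast

theorem theorem2p1: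
  fixes \<nu> :: "real^'m \<Rightarrow> real"
    and \<theta> :: "real^'m"
    and b :: int
    and \<H> :: "(real^'m) set set"
    and T :: "(real^'m) set"
  assumes "is_norm \<nu>"
    and "b \<ge> 2"
    and "countable \<H>"
    and "\<And>H. H \<in> \<H> \<Longrightarrow> affine_hyperplane H"
    and "T = \<Union>\<H>"
  shows "(\<forall>w\<in>{0..<1}.
            packing_dim (singular_set \<nu> \<theta> w - T)
              \<ge> packing_dim (b_ary_singular_set b \<nu> \<theta> w - T) \<and>
            packing_dim (b_ary_singular_set b \<nu> \<theta> w - T)
              \<ge> ereal ((1 - w) * real CARD('m)) \<and>
            (1 - w) * real CARD('m) > 0) \<and>
         packing_dim (singular_set \<nu> \<theta> (1 / real CARD('m)) - T)
           \<ge> packing_dim (b_ary_singular_set b \<nu> \<theta> (1 / real CARD('m)) - T) \<and>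
         packing_dim (b_ary_singular_set b \<nu> \<theta> (1 / real CARD('m)) - T)
           \<ge> ereal (real CARD('m) - 1)"
proof (intro conjI ballI)
  have mono: "packing_dim (b_ary_singular_set b \<nu> \<theta> w - T) \<le> packing_dim (singular_set \<nu> \<theta> w - T)" for w
    by (intro packing_dim_mono Diff_mono b_ary_singular_subset subset_refl)
  have ge: "packing_dim (b_ary_singular_set b \<nu> \<theta> w - T) \<ge> ereal ((1 - w) * real CARD('m))"
    if "0 \<le> w" "w < 1" for w
    unfolding \<open>T = \<Union>\<H>\<close> by (rule packing_dim_b_ary_singular_ge) (use assms that in auto)
  show "packing_dim (b_ary_singular_set b \<nu> \<theta> (1 / real CARD('m)) - T) \<ge> ereal (real CARD('m) - 1)"
  \<comment> \<open>In dimension one the exponent \<open>1 / m = 1\<close> lies outside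
    \<open>[0,1)\<close>, but the bound \<open>m - 1 = 0\<close> holds for every set.\<close>
  proof (cases "CARD('m) = 1")
    case True
    have "packing_dim (b_ary_singular_set b \<nu> \<theta> (1 / real CARD('m)) - T) \<ge> ereal 0"
      by (rule packing_dim_geI) simp
    then show ?thesis using True by simp
  next
    case False
    then have "1 < real CARD('m)" using zero_less_card_finite[where 'a='m] by linarith
    then show ?thesis using ge[of "1 / real CARD('m)"] by (simp add: algebra_simps)
  qed
  fix w :: real assume "w \<in> {0..<1}"
  then show "packing_dim (b_ary_singular_set b \<nu> \<theta> w - T) \<ge> ereal ((1 - w) * real CARD('m))"
    "(1 - w) * real CARD('m) > 0"
    using ge by auto
  show "packing_dim (singular_set \<nu> \<theta> w - T) \<ge> packing_dim (b_ary_singular_set b \<nu> \<theta> w - T)" by (rule mono)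
qed (intro packing_dim_mono Diff_mono b_ary_singular_subset subset_refl)

end
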